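(* A set $A=\{\mathbf{a}_0,\ldots,\mathbf{a}_n\}$ of points of $\mathbb{R}^N$ is geometrically independent if and only if the set of vectors $V=\{\mathbf{a}_1-\mathbf{a}_0,\ldots,\mathbf{a}_n-\mathbf{a}_0\}$ is linearly independent in the sense of linear algebra.
   Context: Here $\mathbb{R}^N$ denotes a Euclidean space regarded as a real vector space with coordinatewise operations; its dimension is not assumed finite: its points may be finite tuples of real numbers or infinite tuples $(x_1,x_2,\ldots)$ of real numbers. The set $A$ is finite, with points indexed $0,\ldots,n$. The set $A$ is geometrically independent if for any real scalars $t_0,\ldots,t_n$, the conditions $\sum_{i=0}^n t_i=0$ and $\sum_{i=0}^n t_i\mathbf{a}_i=\mathbf{0}$ imply $t_i=0$ for all $i$. A set of vectors $\{\mathbf{v}_1,\ldots,\mathbf{v}_m\}$ in $\mathbb{R}^N$ is linearly independent if for any real scalars $\lambda_1,\ldots,\lambda_m$, the condition $\sum_{i=1}^m\lambda_i\mathbf{v}_i=\mathbf{0}$ implies $\lambda_i=0$ for all $i$. *)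

theory Defs
  imports Complex_Main "HOL-Library.Function_Algebras"
begin

(* Points of R^N are tuples of reals, i.e. functions 'i => real, where the index type 'i
   may be finite or infinite.  Function_Algebras supplies the coordinatewise additive
   group; scalar multiplication is coordinatewise as well. *)
instantiation "fun" :: (type, real_vector) real_vector
begin

definition scaleR_fun :: "real \<Rightarrow> ('a \<Rightarrow> 'b) \<Rightarrow> 'a \<Rightarrow> 'b" where
  "scaleR_fun c x = (\<lambda>k. c *\<^sub>R x k)"

instance
  by standard (simp_all add: scaleR_fun_def fun_eq_iff scaleR_add_left scaleR_add_right)

end

(* The coefficients belong to the indices, so a listing with a repeated point is never
   independent. *)
definition geometrically_independent :: "nat \<Rightarrow> (nat \<Rightarrow> 'a::real_vector) \<Rightarrow> bool" where
  "geometrically_independent n a \<longleftrightarrow>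
     (\<forall>t :: nat \<Rightarrow> real.
        (\<Sum>i=0..n. t i) = 0 \<and> (\<Sum>i=0..n. t i *\<^sub>R a i) = 0 \<longrightarrow> (\<forall>i\<in>{0..n}. t i = 0))"

definition linearly_independent :: "nat \<Rightarrow> (nat \<Rightarrow> 'a::real_vector) \<Rightarrow> bool" where
  "linearly_independent m v \<longleftrightarrow>
     (\<forall>l :: nat \<Rightarrow> real.
        (\<Sum>i=1..m. l i *\<^sub>R v i) = 0 \<longrightarrow> (\<forall>i\<in>{1..m}. l i = 0))"

(* For a listing without repetitions this is the library's notion for sets. *)
lemma linearly_independent_iff_independent:
  assumes inj: "inj_on v {1..m}"
  shows "linearly_independent m v \<longleftrightarrow> independent (v ` {1..m})"
proof
  assume L: "linearly_independent m v"
  show "independent (v ` {1..m})"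
  proof (rule independent_if_scalars_zero)
    fix f x assume s: "(\<Sum>x\<in>v ` {1..m}. f x *\<^sub>R x) = 0" and x: "x \<in> v ` {1..m}"
    have "(\<Sum>i=1..m. f (v i) *\<^sub>R v i) = 0"
      using s by (simp only: sum.reindex[OF inj] o_def)
    with L have "\<forall>i\<in>{1..m}. f (v i) = 0"
      unfolding linearly_independent_def by (elim allE[where x = "\<lambda>i. f (v i)"]) simp
    with x show "f x = 0" by auto
  qed simp
next
  assume I: "independent (v ` {1..m})"
  show "linearly_independent m v"
    unfolding linearly_independent_def
  proof (intro allI impI ballI)
    fix l :: "nat \<Rightarrow> real" and i
    assume s: "(\<Sum>i=1..m. l i *\<^sub>R v i) = 0" and i: "i \<in> {1..m}"
    let ?f = "\<lambda>x. l (inv_into {1..m} v x)"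
    have "(\<Sum>x\<in>v ` {1..m}. ?f x *\<^sub>R x) = (\<Sum>i=1..m. l i *\<^sub>R v i)"
      by (subst sum.reindex[OF inj], rule sum.cong) (simp_all only: o_def inv_into_f_f[OF inj])
    with s have z: "(\<Sum>x\<in>v ` {1..m}. ?f x *\<^sub>R x) = 0" by simp
    have "?f (v i) = 0"
      by (rule independentD[OF I _ subset_refl z]) (use i in auto)
    then show "l i = 0" by (simp only: inv_into_f_f[OF inj i])
  qed
qed

end

theory Submission
  imports Defs
begin

text \<open>When coefficients sum to zero, translating all points by \<open>- a 0\<close> does not
  change their combination, and it kills the term of index 0. So an affine relation among the points
  is a linear relation among the differences; this is \<open>sum_scaleR_eq_sum_scaleR_diff\<close>.
  Conversely, coefficients on \<open>{1..n}\<close> extend in exactly one way to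
  \<open>{0..n}\<close> with sum zero. Under this correspondence trivial relations match trivial
  ones.\<close>

lemma sum_scaleR_eq_sum_scaleR_diff:
  fixes a :: "nat \<Rightarrow> 'a::real_vector"
  assumes "(\<Sum>i=0..n. t i) = 0"
  shows "(\<Sum>i=0..n. t i *\<^sub>R a i) = (\<Sum>i=1..n. t i *\<^sub>R (a i - a 0))"
proof -
  have "t 0 = - (\<Sum>i=1..n. t i)"
    using assms by (simp add: sum.atLeast_Suc_atMost)
  \<comment> \<open>The coefficient that \<open>a 0\<close> collects here, minus the sum over
    \<open>{1..n}\<close>, is \<open>t 0\<close>: this supplies the term of index 0.\<close>
  moreover have "(\<Sum>i=1..n. t i *\<^sub>R (a i - a 0)) =
      (\<Sum>i=1..n. t i *\<^sub>R a i) - (\<Sum>i=1..n. t i) *\<^sub>R a 0"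
    by (simp only: scaleR_diff_right sum_subtractf scaleR_sum_left)
  ultimately show ?thesis
    by (simp add: sum.atLeast_Suc_atMost)
qed

text \<open>The argument is pure linear algebra, so it is carried out in an abstract real vector
  space; spaces of tuples, finite or infinite, are instances.\<close>

lemma geometrically_independent_iff_linearly_independent:
  fixes a :: "nat \<Rightarrow> 'a::real_vector"
  shows "geometrically_independent n a \<longleftrightarrow> linearly_independent n (\<lambda>i. a i - a 0)"
proof
  assume G: "geometrically_independent n a"
  show "linearly_independent n (\<lambda>i. a i - a 0)"
    unfolding linearly_independent_def
  proof (intro allI impI)
    fix l :: "nat \<Rightarrow> real"
    assume l: "(\<Sum>i=1..n. l i *\<^sub>R (a i - a 0)) = 0"
    \<comment> \<open>The value at 0 is forced by the demand that the coefficients sum to zero;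
      whatever \<open>l 0\<close> was is overwritten.\<close>
    define t where "t = l(0 := - (\<Sum>i=1..n. l i))"
    have t: "t i = l i" if "i \<in> {1..n}" for i
      using that by (simp add: t_def)
    have "(\<Sum>i=1..n. t i) = (\<Sum>i=1..n. l i)"
      by (rule sum.cong) (simp_all only: t)
    then have t_sum: "(\<Sum>i=0..n. t i) = 0"
      by (simp add: sum.atLeast_Suc_atMost) (simp add: t_def)
    have "(\<Sum>i=1..n. t i *\<^sub>R (a i - a 0)) = (\<Sum>i=1..n. l i *\<^sub>R (a i - a 0))"
      by (rule sum.cong) (simp_all only: t)
    with l have "(\<Sum>i=0..n. t i *\<^sub>R a i) = 0"
      by (simp only: sum_scaleR_eq_sum_scaleR_diff[OF t_sum])
    with G t_sum have "\<forall>i\<in>{0..n}. t i = 0"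
      unfolding geometrically_independent_def by blast
    with t show "\<forall>i\<in>{1..n}. l i = 0"
      by (metis atLeastAtMost_iff le0)
  qed
next
  assume L: "linearly_independent n (\<lambda>i. a i - a 0)"
  show "geometrically_independent n a"
    unfolding geometrically_independent_def
  proof (intro allI impI, elim conjE)
    fix t :: "nat \<Rightarrow> real"
    assume t_sum: "(\<Sum>i=0..n. t i) = 0" and "(\<Sum>i=0..n. t i *\<^sub>R a i) = 0"
    then have "(\<Sum>i=1..n. t i *\<^sub>R (a i - a 0)) = 0"
      by (simp only: sum_scaleR_eq_sum_scaleR_diff)
    with L have t: "\<forall>i\<in>{1..n}. t i = 0"
      unfolding linearly_independent_def by blast
    \<comment> \<open>The linear relation says nothing about index 0; there the zero sum decides,
      also when \<open>n = 0\<close> and \<open>t 0\<close> is the whole sum.\<close>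
    moreover have "t 0 = 0"
      using t_sum t by (simp add: sum.atLeast_Suc_atMost)
    ultimately show "\<forall>i\<in>{0..n}. t i = 0"
      by (metis One_nat_def Suc_leI atLeastAtMost_iff gr0I)
  qed
qed

theorem theorem2p14:
  fixes a :: "nat \<Rightarrow> ('i \<Rightarrow> real)" and n :: nat
  shows "geometrically_independent n a \<longleftrightarrow> linearly_independent n (\<lambda>i. a i - a 0)"
  by (rule geometrically_independent_iff_linearly_independent)

end
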